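(* Let $G$ be a connected finite simple undirected graph. The incidence matrix of $G$ is unimodular if and only if any two odd cycles of $G$ intersect (i.e. any two odd cycles of $G$ have at least one common vertex).
   Context: The incidence matrix of a graph $G$ is the $0/1$ integer matrix with rows indexed by the vertices $V(G)$ and columns indexed by the edges $E(G)$, whose entry at $(v,e)$ is $1$ if $v$ is an endpoint of $e$ and $0$ otherwise. An integer matrix $A$ of rank $d$ is called unimodular if all non-zero $d\times d$ minors of $A$ have the same absolute value. A cycle is a closed walk $(u_0,u_1,\dots,u_\ell=u_0)$ in $G$ (of length $\ell\ge 3$) with $u_1,\dots,u_\ell$ pairwise distinct; it is odd if its length $\ell$ is odd. *)

theory Defs
  imports
    "Jordan_Normal_Form.Determinant"
    "Jordan_Normal_Form.DL_Rank"
    "Jordan_Normal_Form.DL_Submatrix"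
begin

text \<open>A graph is given by its vertex set and its set of edges, an edge being a two-element
  set of vertices (so there are no loops and no parallel edges).\<close>

definition finite_simple_graph :: "'a set \<Rightarrow> 'a set set \<Rightarrow> bool" where
  "finite_simple_graph V E \<longleftrightarrow> finite V \<and> (\<forall>e\<in>E. e \<subseteq> V \<and> card e = 2)"

text \<open>A walk is the nonempty list of the vertices it visits, so its length is one less than
  the length of the list.\<close>

definition is_walk :: "'a set \<Rightarrow> 'a set set \<Rightarrow> 'a list \<Rightarrow> bool" where
  "is_walk V E p \<longleftrightarrow> p \<noteq> [] \<and> set p \<subseteq> V \<and> successively (\<lambda>u v. {u, v} \<in> E) p"

definition walk_length :: "'a list \<Rightarrow> nat" where
  "walk_length p = length p - 1"

definition connected_graph :: "'a set \<Rightarrow> 'a set set \<Rightarrow> bool" where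
  "connected_graph V E \<longleftrightarrow> (\<forall>u\<in>V. \<forall>v\<in>V. \<exists>p. is_walk V E p \<and> hd p = u \<and> last p = v)"

definition is_cycle :: "'a set \<Rightarrow> 'a set set \<Rightarrow> 'a list \<Rightarrow> bool" where
  "is_cycle V E c \<longleftrightarrow>
     is_walk V E c \<and> hd c = last c \<and> walk_length c \<ge> 3 \<and> distinct (tl c)"

definition is_odd_cycle :: "'a set \<Rightarrow> 'a set set \<Rightarrow> 'a list \<Rightarrow> bool" where
  "is_odd_cycle V E c \<longleftrightarrow> is_cycle V E c \<and> odd (walk_length c)"

text \<open>The lists \<open>vs\<close> and \<open>es\<close> enumerate the vertices and the edges; they fix
  the order of the rows and of the columns.\<close>

definition incidence_matrix :: "'a list \<Rightarrow> 'a set list \<Rightarrow> int mat" where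
  "incidence_matrix vs es =
     mat (length vs) (length es) (\<lambda>(i, j). if vs ! i \<in> es ! j then 1 else 0)"

text \<open>The rank of an integer matrix is its rank over the rationals; the first argument of
  \<^const>\<open>vec_space.rank\<close> is the number of rows.\<close>

definition int_mat_rank :: "int mat \<Rightarrow> nat" where
  "int_mat_rank A = vec_space.rank (dim_row A) (map_mat rat_of_int A)"

definition minors :: "nat \<Rightarrow> int mat \<Rightarrow> int set" where
  "minors k A = {det (submatrix A I J) | I J.
     I \<subseteq> {..<dim_row A} \<and> J \<subseteq> {..<dim_col A} \<and> card I = k \<and> card J = k}"

definition unimodular :: "int mat \<Rightarrow> bool" where
  "unimodular A \<longleftrightarrow>
     (\<forall>x \<in> minors (int_mat_rank A) A. \<forall>y \<in> minors (int_mat_rank A) A.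
        x \<noteq> 0 \<longrightarrow> y \<noteq> 0 \<longrightarrow> \<bar>x\<bar> = \<bar>y\<bar>)"

end

theory Submission
  imports Defs "Jordan_Normal_Form.DL_Rank_Submatrix"
begin

text \<open>Let \<open>n\<close> be the number of vertices. Without odd cycles the graph is bipartite, and then
  every minor lies in \<open>{0, 1, -1}\<close>. Otherwise the rank is \<open>n\<close>. If \<open>det B \<noteq> 0\<close> for \<open>n\<close> edge
  columns \<open>B\<close>, then no component of the spanning subgraph with these edges is bipartite, since
  a sign function alternating along its edges would be in the left kernel of \<open>B\<close>. If odd cycles
  always meet, the subgraph is therefore connected, and alternating sums along walks to a root
  \<open>r\<close> give an integer \<open>X\<close> such that \<open>B X\<close> is triangular with columns \<open>e_v \<plusminus> e_r\<close> and \<open>2 e_r\<close>;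
  so \<open>det B\<close> divides \<open>2\<close>, and it is even because every column sums to \<open>2\<close>.

  Conversely, expanding \<open>det (A X) = 2\<close> for the full incidence matrix \<open>A\<close> by multilinearity
  in the columns yields an \<open>n\<close>-minor not divisible by \<open>4\<close>. Given two disjoint odd cycles, the
  same expansion yields a nonzero \<open>n\<close>-minor containing the edges of both; the edges of a cycle
  sum to an even vector, so this minor is divisible by \<open>4\<close>.\<close>

section \<open>Determinants\<close>

lemma dvd_det_column:
  fixes N :: "'a::comm_ring_1 mat"
  assumes N: "N \<in> carrier_mat n n" and k: "k < n"
    and dvd: "\<And>i. i < n \<Longrightarrow> d dvd N $$ (i, k)"
  shows "d dvd det N"
  unfolding laplace_expansion_column[OF N k]
  by (intro dvd_sum dvd_mult2 dvd) auto

text \<open>Cramer's rule for the transpose: replacing row \<open>k\<close> by the combination with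
  coefficients \<open>s\<close> multiplies the determinant by \<open>s k\<close>. Taking
  \<open>d = 0\<close> turns divisibility into vanishing, so a left kernel vector \<open>s\<close>
  gives \<open>s k * det N = 0\<close>.\<close>

lemma dvd_det_row_combination:
  fixes N :: "'a::comm_ring_1 mat"
  assumes N: "N \<in> carrier_mat n n" and k: "k < n"
    and dvd: "\<And>j. j < n \<Longrightarrow> d dvd (\<Sum>i<n. s i * N $$ (i, j))"
  shows "d dvd s k * det N"
proof -
  let ?x = "vec n s" and ?T = "transpose_mat N"
  have T: "?T \<in> carrier_mat n n" using N by simp
  have "d dvd det (replace_col ?T (?T *\<^sub>v ?x) k)"
  proof (rule dvd_det_column[OF _ k])
    show "replace_col ?T (?T *\<^sub>v ?x) k \<in> carrier_mat n n"
      using T by (auto simp: replace_col_def)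
    fix i assume i: "i < n"
    have "(?T *\<^sub>v ?x) $ i = (\<Sum>j<n. s j * N $$ (j, i))"
      using i N by (auto simp: scalar_prod_def lessThan_atLeast0 mult.commute intro!: sum.cong)
    then show "d dvd replace_col ?T (?T *\<^sub>v ?x) k $$ (i, k)"
      using dvd[OF i] i k N by (simp add: replace_col_def)
  qed
  then show ?thesis
    using cramer_lemma_mat[OF T _ k, of ?x] k by (simp add: det_transpose[OF N])
qed

text \<open>Replacing column \<open>k\<close> by the sum of the columns in \<open>S\<close> keeps
  the determinant, and \<open>d\<close> is then factored out of the new column. The quotient matrix
  \<open>N'\<close> is returned because it agrees with \<open>N\<close> off column \<open>k\<close>,
  which lets the lemma be applied again to a disjoint set of columns.\<close>

lemma dvd_det_column_sum:
  fixes N :: "'a::comm_ring_1 mat"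
  assumes N: "N \<in> carrier_mat n n" and S: "S \<subseteq> {..<n}" "k \<in> S"
    and dvd: "\<And>i. i < n \<Longrightarrow> d dvd (\<Sum>j\<in>S. N $$ (i, j))"
  obtains N' where "N' \<in> carrier_mat n n" "det N = d * det N'"
    "\<And>i j. i < n \<Longrightarrow> j < n \<Longrightarrow> j \<noteq> k \<Longrightarrow> N' $$ (i, j) = N $$ (i, j)"
proof -
  have k: "k < n" using S by auto
  have "\<forall>i. \<exists>q. i < n \<longrightarrow> (\<Sum>j\<in>S. N $$ (i, j)) = d * q"
    using dvd by (auto simp: dvd_def)
  then obtain w where w: "\<And>i. i < n \<Longrightarrow> (\<Sum>j\<in>S. N $$ (i, j)) = d * w i" by metis
  let ?x = "vec n (\<lambda>j. if j \<in> S then 1 else 0)"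
  let ?N' = "replace_col N (vec n w) k"
  have N': "?N' \<in> carrier_mat n n" using N by (auto simp: replace_col_def)
  have Nx: "(N *\<^sub>v ?x) $ i = d * w i" if "i < n" for i
  proof -
    have "(N *\<^sub>v ?x) $ i = (\<Sum>j<n. if j \<in> S then N $$ (i, j) else 0)"
      using that N by (auto simp: scalar_prod_def lessThan_atLeast0 intro!: sum.cong)
    also have "\<dots> = (\<Sum>j\<in>S. N $$ (i, j))"
      using S by (simp add: sum.inter_restrict[symmetric] Int_absorb1)
    finally show ?thesis using w[OF that] by simp
  qed
  let ?R = "replace_col N (N *\<^sub>v ?x) k"
  have R: "?R \<in> carrier_mat n n" using N by (auto simp: replace_col_def)
  \<comment> \<open>Cofactors along column \<open>k\<close> do not see that column, so both matrices
    share them.\<close>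
  have del: "mat_delete ?R i k = mat_delete ?N' i k" if "i < n" for i
    using N k that by (auto simp: mat_delete_def replace_col_def)
  have "det N = det ?R"
    using cramer_lemma_mat[OF N _ k, of ?x] S k by simp
  also have "\<dots> = (\<Sum>i<n. d * (?N' $$ (i, k) * cofactor ?N' i k))"
    unfolding laplace_expansion_column[OF R k]
    using N k Nx del by (auto simp: cofactor_def replace_col_def mult.assoc intro!: sum.cong)
  also have "\<dots> = d * det ?N'"
    by (simp add: laplace_expansion_column[OF N' k] sum_distrib_left)
  finally show ?thesis
    using that[OF N'] N by (simp add: replace_col_def)
qed

section \<open>Expansion of a determinant by column choices\<close>

lemma det_mult_eq_sum_column_choices:
  fixes a :: "nat \<Rightarrow> nat \<Rightarrow> 'a::comm_ring_1"
  shows "det (mat n n (\<lambda>(i, j). \<Sum>k<m. a i k * x k j)) =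
    (\<Sum>f | (\<forall>j\<in>{0..<n}. f j \<in> {..<m}) \<and> (\<forall>j. j \<notin> {0..<n} \<longrightarrow> f j = j).
      (\<Prod>j<n. x (f j) j) * det (mat n n (\<lambda>(i, j). a i (f j))))"
proof -
  \<comment> \<open>Rows and columns are exchanged, since \<open>det_linear_rows_sum\<close> expands
    along rows. Its choice functions are fixed to the identity outside \<open>{0..<n}\<close>, which
    leaves finitely many of them.\<close>
  define r where "r k = vec n (\<lambda>i. a i k)" for k
  have r: "r k \<in> carrier_vec n" for k by (simp add: r_def)
  have "mat n n (\<lambda>(i, j). \<Sum>k<m. a i k * x k j) =
      transpose_mat (mat\<^sub>r n n (\<lambda>j. finsum_vec TYPE('a) n (\<lambda>k. x k j \<cdot>\<^sub>v r k) {..<m}))"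
    by (rule eq_matI) (auto simp: r_def index_finsum_vec mult.commute)
  then have "det (mat n n (\<lambda>(i, j). \<Sum>k<m. a i k * x k j)) =
      det (mat\<^sub>r n n (\<lambda>j. finsum_vec TYPE('a) n (\<lambda>k. x k j \<cdot>\<^sub>v r k) {..<m}))"
    by (simp add: det_transpose[OF mat_row_carrierI])
  also have "\<dots> = (\<Sum>f | (\<forall>j\<in>{0..<n}. f j \<in> {..<m}) \<and> (\<forall>j. j \<notin> {0..<n} \<longrightarrow> f j = j).
      det (mat\<^sub>r n n (\<lambda>j. x (f j) j \<cdot>\<^sub>v r (f j))))"
    by (rule det_linear_rows_sum) (auto simp: r)
  also have "\<dots> = (\<Sum>f | (\<forall>j\<in>{0..<n}. f j \<in> {..<m}) \<and> (\<forall>j. j \<notin> {0..<n} \<longrightarrow> f j = j).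
      (\<Prod>j<n. x (f j) j) * det (mat n n (\<lambda>(i, j). a i (f j))))"
  proof (rule sum.cong[OF refl])
    fix f
    have "mat n n (\<lambda>(i, j). a i (f j)) = transpose_mat (mat\<^sub>r n n (\<lambda>j. r (f j)))"
      by (rule eq_matI) (auto simp: r_def)
    then have "det (mat n n (\<lambda>(i, j). a i (f j))) = det (mat\<^sub>r n n (\<lambda>j. r (f j)))"
      by (simp add: det_transpose[OF mat_row_carrierI])
    then show "det (mat\<^sub>r n n (\<lambda>j. x (f j) j \<cdot>\<^sub>v r (f j))) =
        (\<Prod>j<n. x (f j) j) * det (mat n n (\<lambda>(i, j). a i (f j)))"
      by (subst det_rows_mul) (auto simp: r lessThan_atLeast0)
  qed
  finally show ?thesis .
qed

text \<open>A sum not divisible by \<open>d\<close> has a summand not divisible by \<open>d\<close>,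
  and neither factor of that summand is. With \<open>d = 0\<close> this produces a column choice
  with nonzero determinant.\<close>

lemma not_dvd_det_mult_obtain_columns:
  fixes a :: "nat \<Rightarrow> nat \<Rightarrow> 'a::comm_ring_1"
  assumes "\<not> d dvd det (mat n n (\<lambda>(i, j). \<Sum>k<m. a i k * x k j))"
  obtains f where "\<And>j. j < n \<Longrightarrow> f j < m" "\<And>j. j < n \<Longrightarrow> x (f j) j \<noteq> 0"
    "\<not> d dvd det (mat n n (\<lambda>(i, j). a i (f j)))"
proof -
  have "\<exists>f. (\<forall>j\<in>{0..<n}. f j \<in> {..<m}) \<and>
      \<not> d dvd (\<Prod>j<n. x (f j) j) * det (mat n n (\<lambda>(i, j). a i (f j)))"
  proof (rule ccontr)
    assume "\<not> ?thesis"
    then have "d dvd det (mat n n (\<lambda>(i, j). \<Sum>k<m. a i k * x k j))"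
      unfolding det_mult_eq_sum_column_choices by (intro dvd_sum) blast
    with assms show False by simp
  qed
  then obtain f where f: "\<forall>j\<in>{0..<n}. f j \<in> {..<m}"
    and nd: "\<not> d dvd (\<Prod>j<n. x (f j) j) * det (mat n n (\<lambda>(i, j). a i (f j)))"
    by blast
  have "x (f j) j \<noteq> 0" if "j < n" for j
  proof
    assume "x (f j) j = 0"
    then have "(\<Prod>j<n. x (f j) j) = 0" by (intro prod_zero) (use that in auto)
    then show False using nd by simp
  qed
  moreover have "\<not> d dvd det (mat n n (\<lambda>(i, j). a i (f j)))"
    using nd by (metis dvd_mult)
  ultimately show ?thesis using f that[of f] by simp
qed

text \<open>Total unimodularity of bipartite incidence matrices, by induction on \<open>n\<close>.
  If every column has two ones, the rows weighted by \<open>s\<close> sum to zero; otherwise some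
  column has at most one 1, and expanding along it reduces the size. Signs are given at all indices,
  so the shifted rows of the smaller matrix inherit them.\<close>

lemma det_two_coloured_rows:
  fixes N :: "int mat" and s :: "nat \<Rightarrow> int"
  assumes "N \<in> carrier_mat n n"
    and "\<And>i j. i < n \<Longrightarrow> j < n \<Longrightarrow> N $$ (i, j) \<in> {0, 1}"
    and "\<And>i. s i \<in> {1, -1}"
    and "\<And>i i' j. i < n \<Longrightarrow> i' < n \<Longrightarrow> j < n \<Longrightarrow> i \<noteq> i' \<Longrightarrow>
      N $$ (i, j) = 1 \<Longrightarrow> N $$ (i', j) = 1 \<Longrightarrow> s i + s i' = 0"
  shows "\<bar>det N\<bar> \<le> 1"
  using assms
proof (induction n arbitrary: N s)
  case 0
  then show ?case by (simp add: det_dim_zero)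
next
  case (Suc n)
  note N = Suc.prems(1)
  show ?case
  proof (cases "\<forall>j<Suc n. \<exists>i<Suc n. \<exists>i'<Suc n. i \<noteq> i' \<and> N $$ (i, j) = 1 \<and> N $$ (i', j) = 1")
    case True
    have "0 dvd s 0 * det N"
    proof (rule dvd_det_row_combination[OF N])
      fix j assume j: "j < Suc n"
      then obtain i i' where i: "i < Suc n" "i' < Suc n" "i \<noteq> i'" "N $$ (i, j) = 1" "N $$ (i', j) = 1"
        using True by blast
      have s: "s i + s i' = 0" using Suc.prems(4) i j by blast
      \<comment> \<open>A third one in the column would need a sign opposite to both
        \<open>s i\<close> and \<open>s i'\<close>, which are already opposite to each
        other.\<close>
      have "N $$ (k, j) = 0" if k: "k < Suc n" "k \<noteq> i" "k \<noteq> i'" for k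
      proof (rule ccontr)
        assume "N $$ (k, j) \<noteq> 0"
        then have "N $$ (k, j) = 1" using Suc.prems(2)[OF k(1) j] by simp
        then have "s k + s i = 0" "s k + s i' = 0"
          using Suc.prems(4)[of k i j] Suc.prems(4)[of k i' j] i j k by simp_all
        then show False using s Suc.prems(3)[of i] by auto
      qed
      then have "(\<Sum>k<Suc n. s k * N $$ (k, j)) = (\<Sum>k\<in>{i, i'}. s k * N $$ (k, j))"
        using i by (intro sum.mono_neutral_right) auto
      then show "0 dvd (\<Sum>k<Suc n. s k * N $$ (k, j))" using i s by simp
    qed simp
    then show ?thesis using Suc.prems(3)[of 0] by auto
  next
    case False
    then obtain j where j: "j < Suc n" and uniq: "\<And>i i'. i < Suc n \<Longrightarrow> i' < Suc n \<Longrightarrow>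
        N $$ (i, j) = 1 \<Longrightarrow> N $$ (i', j) = 1 \<Longrightarrow> i = i'" by blast
    show ?thesis
    proof (cases "\<exists>i<Suc n. N $$ (i, j) = 1")
      case False
      then have "N $$ (i, j) = 0" if "i < Suc n" for i
        using Suc.prems(2)[OF that j] that by auto
      then have "0 dvd det N" by (intro dvd_det_column[OF N j]) auto
      then show ?thesis by simp
    next
      case True
      then obtain i where i: "i < Suc n" "N $$ (i, j) = 1" by blast
      have z: "N $$ (k, j) = 0" if "k < Suc n" "k \<noteq> i" for k
        using Suc.prems(2)[OF that(1) j] uniq i that by auto
      let ?D = "mat_delete N i j"
      have D: "?D \<in> carrier_mat n n" using mat_delete_carrier[OF N] by simp
      have ins: "insert_index i k < Suc n" if "k < n" for i k
        using that by (simp add: insert_index_def)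
      have inj: "insert_index i k \<noteq> insert_index i k'" if "k \<noteq> k'" for k k'
        using that by (auto simp: insert_index_def)
      have idx: "?D $$ (k, l) = N $$ (insert_index i k, insert_index j l)" if "k < n" "l < n" for k l
        using mat_delete_index[OF N i(1) j that] by simp
      have "\<bar>det ?D\<bar> \<le> 1"
      proof (rule Suc.IH[OF D])
        show "?D $$ (k, l) \<in> {0, 1}" if "k < n" "l < n" for k l
          unfolding idx[OF that] by (rule Suc.prems(2)[OF ins[OF that(1)] ins[OF that(2)]])
        show "s (insert_index i k) \<in> {1, -1}" for k by (rule Suc.prems(3))
        show "s (insert_index i k) + s (insert_index i k') = 0"
          if "k < n" "k' < n" "l < n" "k \<noteq> k'" "?D $$ (k, l) = 1" "?D $$ (k', l) = 1" for k k' l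
          using that(5,6) unfolding idx[OF that(1,3)] idx[OF that(2,3)]
          by (rule Suc.prems(4)[OF ins[OF that(1)] ins[OF that(2)] ins[OF that(3)] inj[OF that(4)]])
      qed
      moreover have "det N = (\<Sum>k\<in>{i}. N $$ (k, j) * cofactor N k j)"
        unfolding laplace_expansion_column[OF N j]
        using i z by (intro sum.mono_neutral_right) auto
      ultimately show ?thesis using i by (simp add: cofactor_def abs_mult power_abs)
    qed
  qed
qed

section \<open>Column selections, submatrices and the rank\<close>

lemma det_select_distinct_columns:
  fixes a :: "nat \<Rightarrow> nat \<Rightarrow> 'a::comm_ring_1"
  assumes "det (mat n n (\<lambda>(i, j). a i (f j))) \<noteq> 0"
  shows "inj_on f {..<n}"
proof (rule inj_onI, rule ccontr)
  fix j k assume jk: "j \<in> {..<n}" "k \<in> {..<n}" "f j = f k" "j \<noteq> k"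
  have "det (mat n n (\<lambda>(i, j). a i (f j))) = 0"
    by (rule det_identical_columns[of _ n j k]) (use jk in \<open>auto simp: Matrix.col_def\<close>)
  with assms show False by simp
qed

lemma pick_lessThan:
  assumes "i < n" shows "pick {..<n} i = i"
proof -
  have *: "{a. a < n \<and> a \<in> UNIV} = {..<n}" by auto
  have "i < card {a. a < n \<and> a \<in> (UNIV::nat set)}" unfolding * using assms by simp
  from pick_reduce_set[OF this] show ?thesis unfolding * pick_UNIV ..
qed

lemma submatrix_all_rows:
  assumes A: "A \<in> carrier_mat n m" and J: "J \<subseteq> {..<m}"
  shows "submatrix A {..<n} J = mat n (card J) (\<lambda>(i, j). A $$ (i, pick J j))"
proof -
  have rows: "{i. i < dim_row A \<and> i \<in> {..<n}} = {..<n}"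
    and cols: "{j. j < dim_col A \<and> j \<in> J} = J" using A J by auto
  show ?thesis unfolding submatrix_def rows cols
    by (rule eq_matI) (simp_all add: pick_lessThan)
qed

lemma pick_bij:
  assumes "finite J" shows "bij_betw (pick J) {..<card J} J"
proof -
  have inj: "inj_on (pick J) {..<card J}"
    by (rule inj_on_inverseI[where g = "\<lambda>a. card {b\<in>J. b < a}"]) (simp add: card_pick)
  have "pick J ` {..<card J} \<subseteq> J" using pick_in_set by auto
  then have "pick J ` {..<card J} = J"
    by (intro card_subset_eq) (auto simp: assms card_image[OF inj])
  then show ?thesis using inj by (simp add: bij_betw_def)
qed

text \<open>\<open>submatrix\<close> lists the columns in increasing order, while \<open>f\<close>
  may list them in any order; the permutation between the two affects only the sign.\<close>

lemma abs_det_select_columns: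
  fixes A :: "int mat"
  assumes A: "A \<in> carrier_mat n m" and f: "inj_on f {..<n}" "f ` {..<n} \<subseteq> {..<m}"
  shows "\<bar>det (mat n n (\<lambda>(i, j). A $$ (i, f j)))\<bar> = \<bar>det (submatrix A {..<n} (f ` {..<n}))\<bar>"
proof -
  let ?J = "f ` {..<n}"
  have fin: "finite ?J" and card: "card ?J = n" using f by (auto simp: card_image)
  \<comment> \<open>The identity outside \<open>{..<n}\<close> makes \<open>p\<close> a permutation
    in the sense of \<open>permutes\<close>.\<close>
  define p where "p j = (if j < n then inv_into {..<n} (pick ?J) (f j) else j)" for j
  have pick: "bij_betw (pick ?J) {..<n} ?J" using pick_bij[OF fin] card by simp
  have "bij_betw (inv_into {..<n} (pick ?J) \<circ> f) {..<n} {..<n}"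
    using bij_betw_trans[OF _ bij_betw_inv_into[OF pick]] f(1) by (auto simp: bij_betw_def)
  then have "bij_betw p {0..<n} {0..<n}"
    by (subst (asm) bij_betw_cong[of _ _ p]) (auto simp: p_def lessThan_atLeast0)
  then have perm: "p permutes {0..<n}" by (rule bij_imp_permutes) (simp add: p_def)
  have pickp: "pick ?J (p j) = f j" if "j < n" for j
    using that pick by (simp add: p_def f_inv_into_f bij_betw_imp_surj_on)
  let ?S = "submatrix A {..<n} ?J"
  have S: "?S = mat n n (\<lambda>(i, j). A $$ (i, pick ?J j))"
    using submatrix_all_rows[OF A f(2)] card by simp
  have ST: "transpose_mat ?S \<in> carrier_mat n n" by (simp add: S)
  have pn: "p j < n" if "j < n" for j using permutes_in_image[OF perm, of j] that by simp
  have "mat n n (\<lambda>(i, j). A $$ (i, f j)) =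
      transpose_mat (mat n n (\<lambda>(i, j). transpose_mat ?S $$ (p i, j)))"
    using pn pickp by (intro eq_matI) (auto simp: S)
  then have "det (mat n n (\<lambda>(i, j). A $$ (i, f j))) = signof p * det ?S"
    using det_permute_rows[OF ST perm] by (simp add: det_transpose[of _ n] S)
  then show ?thesis by (simp add: abs_mult sign_def)
qed

lemma rank_le_rows:
  fixes B :: "rat mat"
  assumes "B \<in> carrier_mat n m"
  shows "vec_space.rank n B \<le> n"
proof -
  interpret vec_space "TYPE(rat)" n .
  have "set (cols B) \<subseteq> carrier_vec n" using assms cols_dim by blast
  then show ?thesis
    using subspace_dim[OF span_is_subspace fin_dim fin_dim_span_cols[OF assms]]
    by (simp add: rank_def dim_is_n)
qed

text \<open>The nonzero minor, carried over to the rationals, bounds the rank from below, and the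
  number of rows bounds it from above.\<close>

lemma int_mat_rank_full:
  assumes A: "A \<in> carrier_mat n m" and f: "\<And>j. j < n \<Longrightarrow> f j < m"
    and nz: "det (mat n n (\<lambda>(i, j). A $$ (i, f j))) \<noteq> 0"
  shows "int_mat_rank A = n"
proof -
  interpret vec_space "TYPE(rat)" n .
  let ?J = "f ` {..<n}" and ?Q = "map_mat rat_of_int"
  have inj: "inj_on f {..<n}" using det_select_distinct_columns[of n "\<lambda>i k. A $$ (i, k)", OF nz] .
  have J: "?J \<subseteq> {..<m}" using f by auto
  have QA: "?Q A \<in> carrier_mat n m" using A by simp
  have "submatrix (?Q A) {..<n} ?J = ?Q (submatrix A {..<n} ?J)"
    unfolding submatrix_all_rows[OF A J] submatrix_all_rows[OF QA J]
    using A pick_in_set[of _ ?J] J by (intro eq_matI) (simp_all add: subset_iff)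
  moreover have "det (submatrix A {..<n} ?J) \<noteq> 0"
    using abs_det_select_columns[OF A inj J] nz by simp
  ultimately have "det (submatrix (?Q A) {..<n} ?J) \<noteq> 0"
    by simp
  from rank_gt_minor[OF QA this] have "card {j. j < m \<and> j \<in> ?J} \<le> rank (?Q A)" .
  moreover have "{j. j < m \<and> j \<in> ?J} = ?J" using J by auto
  ultimately have "n \<le> rank (?Q A)" using inj by (simp add: card_image)
  then show ?thesis using rank_le_rows[OF QA] A by (simp add: int_mat_rank_def)
qed

section \<open>Walks, cycles and signs\<close>

definition walk_betw :: "'a set \<Rightarrow> 'a set set \<Rightarrow> 'a \<Rightarrow> 'a list \<Rightarrow> 'a \<Rightarrow> bool" where
  "walk_betw V E u p v \<longleftrightarrow> is_walk V E p \<and> hd p = u \<and> last p = v"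

lemma walk_betw_singleton: "u \<in> V \<Longrightarrow> walk_betw V E u [u] u"
  by (simp add: walk_betw_def is_walk_def)

lemma walk_betw_Cons:
  "walk_betw V E v p w \<Longrightarrow> {u, v} \<in> E \<Longrightarrow> u \<in> V \<Longrightarrow> walk_betw V E u (u # p) w"
  by (auto simp: walk_betw_def is_walk_def successively_Cons)

text \<open>The junction \<open>v\<close> ends \<open>p\<close> and begins \<open>q\<close>, so one
  of its two copies is dropped.\<close>

lemma walk_betw_append:
  assumes "walk_betw V E u p v" "walk_betw V E v q w"
  shows "walk_betw V E u (p @ tl q) w" "walk_length (p @ tl q) = walk_length p + walk_length q"
proof -
  obtain x q' where q: "q = x # q'" using assms(2) by (cases q) (auto simp: walk_betw_def is_walk_def)
  show "walk_betw V E u (p @ tl q) w"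
    using assms by (auto simp: q walk_betw_def is_walk_def successively_append_iff successively_Cons)
  show "walk_length (p @ tl q) = walk_length p + walk_length q"
    using assms(1) by (cases p) (auto simp: q walk_length_def walk_betw_def is_walk_def)
qed

lemma walk_betw_rev:
  assumes "walk_betw V E u p v" shows "walk_betw V E v (rev p) u"
  using assms by (simp add: walk_betw_def is_walk_def hd_rev last_rev insert_commute)

lemma walk_betw_prefix:
  assumes "walk_betw V E u p v" "x \<in> set p"
  obtains q where "walk_betw V E u q x"
proof -
  obtain ys zs where p: "p = ys @ x # zs" using assms(2) by (meson split_list)
  have "walk_betw V E u (ys @ [x]) x"
    using assms(1) by (auto simp: p walk_betw_def is_walk_def successively_append_iff hd_append)
  then show ?thesis by (rule that)
qed

lemma walk_betw_induct [consumes 1, case_names singleton Cons]: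
  assumes "walk_betw V E u p v"
    and "v \<in> V \<Longrightarrow> P v [v]"
    and "\<And>u u' p. \<lbrakk>u \<in> V; {u, u'} \<in> E; walk_betw V E u' p v; P u' p\<rbrakk> \<Longrightarrow> P u (u # p)"
  shows "P u p"
  using assms(1)
proof (induction p arbitrary: u)
  case Nil
  then show ?case by (simp add: walk_betw_def is_walk_def)
next
  case (Cons x p)
  show ?case
  proof (cases "p = []")
    case True
    then show ?thesis using Cons.prems assms(2) by (auto simp: walk_betw_def is_walk_def)
  next
    case False
    then have "u = x" "x \<in> V" "{x, hd p} \<in> E" "walk_betw V E (hd p) p v"
      using Cons.prems by (auto simp: walk_betw_def is_walk_def successively_Cons)
    then show ?thesis using Cons.IH assms(3) by blast
  qed
qed

lemma walk_length_Cons: "p \<noteq> [] \<Longrightarrow> walk_length (u # p) = Suc (walk_length p)"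
  by (cases p) (auto simp: walk_length_def)

lemma walk_betw_nonempty: "walk_betw V E u p v \<Longrightarrow> p \<noteq> []"
  by (simp add: walk_betw_def is_walk_def)

lemma walk_betw_in: "walk_betw V E u p v \<Longrightarrow> u \<in> V \<and> v \<in> V"
  by (auto simp: walk_betw_def is_walk_def)

section \<open>Odd closed walks and odd cycles\<close>

lemma odd_closed_walk_conjugate:
  assumes "walk_betw V E u p v" "walk_betw V E v q v" "odd (walk_length q)"
  obtains q' where "walk_betw V E u q' u" "odd (walk_length q')"
proof -
  \<comment> \<open>The walk follows \<open>p\<close>, goes once around \<open>q\<close> and returns
    along \<open>p\<close> reversed, so its length has the parity of that of
    \<open>q\<close>.\<close>
  note 1 = walk_betw_append[OF assms(1,2)]
  note 2 = walk_betw_append[OF 1(1) walk_betw_rev[OF assms(1)]]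
  have "walk_length (rev p) = walk_length p" by (simp add: walk_length_def)
  then show ?thesis using that[OF 2(1)] 1(2) 2(2) assms(3) by simp
qed

text \<open>Strong induction on the length: a vertex repeated in the tail splits the closed walk
  into two shorter closed walks whose lengths add up, and one of them is odd. If nothing is
  repeated, length 1 would mean a loop, so the walk is itself a cycle.\<close>

lemma odd_closed_walk_imp_odd_cycle:
  assumes "\<forall>e\<in>E. card e = 2" "walk_betw V E u p u" "odd (walk_length p)"
  obtains c where "is_odd_cycle V E c" "set c \<subseteq> set p"
proof -
  have "\<exists>c. is_odd_cycle V E c \<and> set c \<subseteq> set p"
    using assms(2,3)
  proof (induction "length p" arbitrary: u p rule: less_induct)
    case less
    show ?case
    proof (cases "distinct (tl p)")
      case True
      have "walk_length p \<noteq> 1"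
      proof
        assume "walk_length p = 1"
        then have "length p = 2" by (simp add: walk_length_def)
        then obtain x y where "p = [x, y]" by (auto simp: length_Suc_conv numeral_2_eq_2)
        then have "{u, u} \<in> E" using less.prems by (auto simp: walk_betw_def is_walk_def)
        then show False using assms(1) by force
      qed
      then have "walk_length p \<ge> 3" using less.prems(2) by presburger
      then have "is_odd_cycle V E p"
        using less.prems True by (auto simp: is_odd_cycle_def is_cycle_def walk_betw_def)
      then show ?thesis by blast
    next
      case False
      obtain h t where p: "p = h # t" using less.prems by (cases p) (auto simp: walk_length_def)
      then obtain xs ys zs y where t: "t = xs @ [y] @ ys @ [y] @ zs"
        using False not_distinct_decomp[of t] by auto
      \<comment> \<open>\<open>?p1\<close> is the detour between two visits of \<open>y\<close>, and
        \<open>?p2\<close> is the walk with this detour cut out.\<close>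
      let ?p1 = "y # ys @ [y]" and ?p2 = "h # xs @ y # zs"
      have w1: "walk_betw V E y ?p1 y" and w2: "walk_betw V E u ?p2 u"
        using less.prems(1) unfolding p t walk_betw_def is_walk_def
        by (auto simp: successively_append_iff successively_Cons hd_append split: if_splits)
      have len: "walk_length p = walk_length ?p1 + walk_length ?p2"
        by (simp add: p t walk_length_def)
      have l: "length ?p1 < length p" "length ?p2 < length p" by (simp_all add: p t)
      have s: "set ?p1 \<subseteq> set p" "set ?p2 \<subseteq> set p" by (auto simp: p t)
      show ?thesis
      proof (cases "odd (walk_length ?p1)")
        case True
        then show ?thesis using less.hyps[OF l(1) w1] s by blast
      next
        case False
        then have "odd (walk_length ?p2)" using len less.prems(2) by simp
        then show ?thesis using less.hyps[OF l(2) w2] s by blast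
      qed
    qed
  qed
  then show ?thesis using that by blast
qed

section \<open>Alternating signs and edge combinations along walks\<close>

lemma alternating_along_walk:
  fixes s :: "'a \<Rightarrow> int"
  assumes "walk_betw V E u p v" "\<And>x y. {x, y} \<in> E \<Longrightarrow> s x + s y = 0"
  shows "s u = (-1) ^ walk_length p * s v"
  using assms(1)
proof (induction rule: walk_betw_induct)
  case singleton
  then show ?case by (simp add: walk_length_def)
next
  case (Cons u u' p)
  then show ?case
    using assms(2)[OF Cons(2)] by (simp add: walk_length_Cons walk_betw_nonempty)
qed

text \<open>The sign of \<open>v\<close> is the parity of a walk from \<open>v\<close> to
  \<open>r\<close>; two such walks close up to a walk at \<open>r\<close>, which is even, so the
  choice does not matter.\<close>

lemma bipartite_component_signs:
  fixes r :: 'a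
  assumes V: "\<Union>E \<subseteq> V" and r: "r \<in> V"
    and no: "\<And>p. walk_betw V E r p r \<Longrightarrow> even (walk_length p)"
  obtains s :: "'a \<Rightarrow> int" where "\<And>v p. walk_betw V E r p v \<Longrightarrow> s v \<in> {1, -1}"
    "\<And>x y. {x, y} \<in> E \<Longrightarrow> s x + s y = 0"
proof -
  \<comment> \<open>The value 0 off the component of \<open>r\<close> makes the alternation hold
    along all edges, not only along those of the component.\<close>
  define s :: "'a \<Rightarrow> int" where "s v = (if \<exists>p. walk_betw V E v p r
    then (-1) ^ walk_length (SOME p. walk_betw V E v p r) else 0)" for v
  have s: "s v = (-1) ^ walk_length p" if p: "walk_betw V E v p r" for v p
  proof -
    let ?q = "SOME p. walk_betw V E v p r"
    have q: "walk_betw V E v ?q r" using p by (rule someI)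
    have "even (walk_length (rev p @ tl ?q))"
      by (rule no[OF walk_betw_append(1)[OF walk_betw_rev[OF p] q]])
    moreover have "walk_length (rev p @ tl ?q) = walk_length p + walk_length ?q"
      using walk_betw_append(2)[OF walk_betw_rev[OF p] q] by (simp add: walk_length_def)
    ultimately have "even (walk_length ?q) \<longleftrightarrow> even (walk_length p)" by simp
    moreover have "s v = (-1) ^ walk_length ?q" using p by (auto simp: s_def)
    ultimately show ?thesis by (simp add: minus_one_power_iff)
  qed
  show ?thesis
  proof
    fix v p assume "walk_betw V E r p v"
    from s[OF walk_betw_rev[OF this]] show "s v \<in> {1, -1}" by (simp add: minus_one_power_iff)
  next
    fix x y assume e: "{x, y} \<in> E"
    then have xy: "x \<in> V" "y \<in> V" "{y, x} \<in> E" using V by (auto simp: insert_commute)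
    show "s x + s y = 0"
    proof (cases "\<exists>p. walk_betw V E y p r")
      case True
      then obtain p where p: "walk_betw V E y p r" by blast
      from s[OF walk_betw_Cons[OF p e xy(1)]] s[OF p] show ?thesis
        by (simp add: walk_length_Cons walk_betw_nonempty[OF p])
    next
      case False
      then have "\<not> (\<exists>p. walk_betw V E x p r)" using walk_betw_Cons[OF _ xy(3,2)] by blast
      then show ?thesis using False by (simp add: s_def)
    qed
  qed
qed

text \<open>The alternating sum of the edge vectors along a walk telescopes to its two ends. For a
  closed odd walk at \<open>u\<close> it is twice the unit vector of \<open>u\<close>.\<close>

lemma walk_edge_combination:
  fixes g :: "nat \<Rightarrow> 'a set"
  assumes "walk_betw V (g ` {..<m}) u p v" "\<forall>k<m. card (g k) = 2"
  obtains c :: "nat \<Rightarrow> int" where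
    "\<And>w. (\<Sum>k<m. of_bool (w \<in> g k) * c k) = of_bool (w = u) - (-1) ^ walk_length p * of_bool (w = v)"
proof -
  have "\<exists>c :: nat \<Rightarrow> int. \<forall>w. (\<Sum>k<m. of_bool (w \<in> g k) * c k) =
      of_bool (w = u) - (-1) ^ walk_length p * of_bool (w = v)"
    using assms(1)
  proof (induction rule: walk_betw_induct)
    case singleton
    show ?case by (rule exI[of _ "\<lambda>_. 0"]) (simp add: walk_length_def)
  next
    case (Cons u u' p)
    then obtain c :: "nat \<Rightarrow> int" where c: "\<And>w. (\<Sum>k<m. of_bool (w \<in> g k) * c k) =
      of_bool (w = u') - (-1) ^ walk_length p * of_bool (w = v)" by blast
    obtain k where k: "k < m" "g k = {u, u'}" using Cons(2) by force
    then have "u \<noteq> u'" using assms(2) by (metis card_2_iff doubleton_eq_iff)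
    \<comment> \<open>The first edge contributes \<open>e_u + e_u'\<close>; subtracting the
      combination for the rest of the walk cancels \<open>e_u'\<close> and flips the sign at
      \<open>v\<close>.\<close>
    have "(\<Sum>l<m. of_bool (w \<in> g l) * (of_bool (l = k) - c l)) =
        of_bool (w = u) - (-1) ^ walk_length (u # p) * of_bool (w = v)" for w
    proof -
      have "(\<Sum>l<m. of_bool (w \<in> g l) * (of_bool (l = k) - c l)) =
          (\<Sum>l<m. if l = k then of_bool (w \<in> g l) else 0) - (\<Sum>l<m. of_bool (w \<in> g l) * c l)"
        unfolding sum_subtractf[symmetric] by (intro sum.cong) (auto simp: algebra_simps)
      also have "(\<Sum>l<m. if l = k then of_bool (w \<in> g l) else 0 :: int) = of_bool (w = u) + of_bool (w = u')"
        using k \<open>u \<noteq> u'\<close> by auto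
      finally show ?thesis using c walk_betw_nonempty[OF Cons(3)] by (simp add: walk_length_Cons)
    qed
    then show ?case by (intro exI[of _ "\<lambda>l. of_bool (l = k) - c l"]) blast
  qed
  then show ?thesis using that by blast
qed

text \<open>\<open>\<sigma>\<close> sends a vertex to the next one on the cycle, so the edges of the
  cycle are indexed by its vertices. The last claim confines the closed walk to these edges, so that
  parity arguments around \<open>c\<close> need nothing about other edges.\<close>

lemma cycle_successor:
  assumes c: "is_cycle V E c"
  obtains \<sigma> where "bij_betw \<sigma> (set c) (set c)" "\<And>v. v \<in> set c \<Longrightarrow> {v, \<sigma> v} \<in> E"
    "walk_betw (set c) ((\<lambda>v. {v, \<sigma> v}) ` set c) (hd c) c (hd c)"
proof -
  have len: "length c \<ge> 4" and cl: "hd c = last c" and dist: "distinct (tl c)"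
    and ne: "c \<noteq> []" and succ: "successively (\<lambda>u v. {u, v} \<in> E) c"
    using c by (auto simp: is_cycle_def is_walk_def walk_length_def)
  \<comment> \<open>\<open>butlast c\<close> and \<open>tl c\<close> both list each vertex of the
    cycle once, the second being the first rotated by one place; pairing them by position gives the
    successor.\<close>
  let ?b = "butlast c"
  have "?b \<noteq> []" using len by (cases c rule: rev_cases) auto
  then have "hd ?b = hd c" by (cases c rule: rev_cases) (auto simp: hd_append)
  moreover have "rotate1 ?b = tl ?b @ [hd ?b]" using \<open>?b \<noteq> []\<close> by (cases ?b) auto
  moreover have "tl c = tl ?b @ [last c]" using \<open>?b \<noteq> []\<close> by (cases c rule: rev_cases) auto
  ultimately have rot: "rotate1 ?b = tl c" using cl by simp
  have distb: "distinct ?b" using dist unfolding rot[symmetric] by simp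
  have setb: "set ?b = set (tl c)" unfolding rot[symmetric] by simp
  have setc: "set c = set (tl c)" using last_in_set[of "tl c"] len cl
    by (cases c) (auto split: if_splits)
  define \<sigma> where "\<sigma> v = the (map_of (zip ?b (tl c)) v)" for v
  have lb: "length ?b = length (tl c)" by simp
  have \<sigma>: "\<sigma> (?b ! i) = tl c ! i" if "i < length ?b" for i
    using map_of_zip_nth[OF lb distb, of i] that by (simp add: \<sigma>_def)
  have step: "{c ! i, c ! Suc i} = {?b ! i, \<sigma> (?b ! i)}" if "Suc i < length c" for i
    using that \<sigma>[of i] by (simp add: nth_butlast nth_tl)
  have all: "\<exists>i. Suc i < length c \<and> v = ?b ! i" if "v \<in> set c" for v
  proof -
    have "v \<in> set ?b" using that setb setc by simp
    then show ?thesis by (force simp: in_set_conv_nth)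
  qed
  have "map \<sigma> ?b = tl c" by (rule nth_equalityI) (use \<sigma> in auto)
  then have img: "\<sigma> ` set c = set c" by (metis set_map setb setc)
  show ?thesis
  proof
    show "bij_betw \<sigma> (set c) (set c)"
      unfolding bij_betw_def using img by (simp add: eq_card_imp_inj_on)
    show "{v, \<sigma> v} \<in> E" if "v \<in> set c" for v
      using all[OF that] step successively_nth[OF succ] by metis
    have "successively (\<lambda>u v. {u, v} \<in> (\<lambda>v. {v, \<sigma> v}) ` set c) c"
      unfolding successively_conv_nth
    proof (intro allI impI)
      fix i assume i: "Suc i < length c"
      then have "?b ! i \<in> set c" using setb setc nth_mem[of i ?b] by simp
      then show "{c ! i, c ! Suc i} \<in> (\<lambda>v. {v, \<sigma> v}) ` set c"
        unfolding step[OF i] by blast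
    qed
    then show "walk_betw (set c) ((\<lambda>v. {v, \<sigma> v}) ` set c) (hd c) c (hd c)"
      using ne cl by (simp add: walk_betw_def is_walk_def)
  qed
qed

section \<open>Minors of the incidence matrix\<close>

lemma sum_nth_distinct:
  assumes "distinct vs"
  shows "(\<Sum>i<length vs. h (vs ! i)) = sum h (set vs)"
  by (rule sum.reindex_bij_betw) (use assms in \<open>auto simp: bij_betw_def inj_on_nth set_conv_nth\<close>)

lemma sum_edge_signs:
  fixes S :: "'a \<Rightarrow> int"
  assumes "distinct vs" "x \<in> set vs" "y \<in> set vs" "x \<noteq> y"
  shows "(\<Sum>i<length vs. S (vs ! i) * of_bool (vs ! i \<in> {x, y})) = S x + S y"
proof -
  have "(\<Sum>i<length vs. S (vs ! i) * of_bool (vs ! i \<in> {x, y})) = (\<Sum>w\<in>set vs. S w * of_bool (w \<in> {x, y}))"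
    by (rule sum_nth_distinct[OF assms(1)])
  also have "\<dots> = (\<Sum>w\<in>{x, y}. S w * of_bool (w \<in> {x, y}))"
    using assms by (intro sum.mono_neutral_right) auto
  finally show ?thesis using assms(4) by simp
qed

section \<open>Square matrices of edge columns\<close>

lemma det_nonzero_vertex_signs:
  fixes N :: "int mat"
  assumes vs: "distinct vs" and N: "N \<in> carrier_mat (length vs) (length vs)"
    and ker: "\<And>S v. (\<And>j. j < length vs \<Longrightarrow> (\<Sum>i<length vs. S (vs ! i) * N $$ (i, j)) = 0) \<Longrightarrow>
      v \<in> set vs \<Longrightarrow> S v = 0"
  shows "det N \<noteq> 0"
proof
  let ?n = "length vs"
  have T: "transpose_mat N \<in> carrier_mat ?n ?n" using N by simp
  assume "det N = 0"
  then have "det (transpose_mat N) = 0" by (simp add: det_transpose[OF N])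
  then obtain x where x: "x \<in> carrier_vec ?n" "x \<noteq> 0\<^sub>v ?n" "transpose_mat N *\<^sub>v x = 0\<^sub>v ?n"
    using det_0_iff_vec_prod_zero[OF T] by blast
  \<comment> \<open>A kernel vector indexed by rows becomes a function on vertices, the form in
    which sign arguments along walks apply.\<close>
  define S where "S v = x $ inv_into {..<?n} (nth vs) v" for v
  have S: "S (vs ! i) = x $ i" if "i < ?n" for i
    using that vs by (simp add: S_def inj_on_nth inv_into_f_f)
  have "(\<Sum>i<?n. S (vs ! i) * N $$ (i, j)) = 0" if j: "j < ?n" for j
  proof -
    have "(\<Sum>i<?n. S (vs ! i) * N $$ (i, j)) = (transpose_mat N *\<^sub>v x) $ j"
      using j N x(1) S by (auto simp: scalar_prod_def lessThan_atLeast0 mult.commute intro!: sum.cong)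
    then show ?thesis using x(3) j by simp
  qed
  from ker[OF this] have "x $ i = 0" if "i < ?n" for i
    using S[OF that] that by simp
  then have "x = 0\<^sub>v ?n" using x(1) by (intro eq_vecI) auto
  with x(2) show False by simp
qed

text \<open>Column \<open>j\<close> is the combination along a walk from \<open>vs ! j\<close> to
  the root \<open>vs ! 0\<close>, and column 0 uses an odd closed walk at the root. The result is
  triangular with diagonal 2, 1, ..., 1.\<close>

lemma exists_edge_combination_det_2:
  fixes g :: "nat \<Rightarrow> 'a set"
  assumes vs: "distinct vs" "vs \<noteq> []" and card: "\<forall>k<m. card (g k) = 2"
    and conn: "\<And>v. v \<in> set vs \<Longrightarrow> \<exists>p. walk_betw (set vs) (g ` {..<m}) v p (vs ! 0)"
    and odd: "walk_betw (set vs) (g ` {..<m}) (vs ! 0) q (vs ! 0)" "odd (walk_length q)"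
  obtains x :: "nat \<Rightarrow> nat \<Rightarrow> int" where
    "det (mat (length vs) (length vs) (\<lambda>(i, j). \<Sum>k<m. of_bool (vs ! i \<in> g k) * x k j)) = 2"
proof -
  let ?n = "length vs" and ?W = "walk_betw (set vs) (g ` {..<m})"
  have "\<exists>(p :: 'a list) (c :: nat \<Rightarrow> int). (j = 0 \<longrightarrow> odd (walk_length p)) \<and> (\<forall>w. (\<Sum>k<m. of_bool (w \<in> g k) * c k) =
      of_bool (w = vs ! j) - (-1) ^ walk_length p * of_bool (w = vs ! 0))" if "j < ?n" for j
  proof -
    obtain p where p: "?W (vs ! j) p (vs ! 0)" "j = 0 \<longrightarrow> odd (walk_length p)"
    proof (cases "j = 0")
      case True
      then show ?thesis using odd that by blast
    next
      case False
      then show ?thesis using conn[of "vs ! j"] \<open>j < ?n\<close> that by auto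
    qed
    obtain c :: "nat \<Rightarrow> int" where "\<And>w. (\<Sum>k<m. of_bool (w \<in> g k) * c k) =
        of_bool (w = vs ! j) - (-1) ^ walk_length p * of_bool (w = vs ! 0)"
      using walk_edge_combination[OF p(1) card] by blast
    with p(2) show ?thesis by (intro exI[of _ p] exI[of _ c] conjI allI)
  qed
  then have "\<forall>j. \<exists>(p :: 'a list) (c :: nat \<Rightarrow> int). j < ?n \<longrightarrow> (j = 0 \<longrightarrow> odd (walk_length p)) \<and>
      (\<forall>w. (\<Sum>k<m. of_bool (w \<in> g k) * c k) =
        of_bool (w = vs ! j) - (-1) ^ walk_length p * of_bool (w = vs ! 0))" by blast
  from choice[OF this] obtain p :: "nat \<Rightarrow> 'a list" where "\<forall>j. \<exists>c :: nat \<Rightarrow> int. j < ?n \<longrightarrow>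
      (j = 0 \<longrightarrow> odd (walk_length (p j))) \<and> (\<forall>w. (\<Sum>k<m. of_bool (w \<in> g k) * c k) =
        of_bool (w = vs ! j) - (-1) ^ walk_length (p j) * of_bool (w = vs ! 0))" by blast
  from choice[OF this] obtain c :: "nat \<Rightarrow> nat \<Rightarrow> int" where *:
    "\<forall>j<?n. (j = 0 \<longrightarrow> odd (walk_length (p j))) \<and> (\<forall>w. (\<Sum>k<m. of_bool (w \<in> g k) * c j k) =
        of_bool (w = vs ! j) - (-1) ^ walk_length (p j) * of_bool (w = vs ! 0))" by blast
  have p: "odd (walk_length (p 0))" using * vs(2) length_greater_0_conv by blast
  have c: "(\<Sum>k<m. of_bool (w \<in> g k) * c j k) =
      of_bool (w = vs ! j) - (-1) ^ walk_length (p j) * of_bool (w = vs ! 0)" if "j < ?n" for j w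
    using * that by blast
  let ?C = "mat ?n ?n (\<lambda>(i, j). of_bool (i = j) - (-1) ^ walk_length (p j) * of_bool (i = 0)) :: int mat"
  have C: "mat ?n ?n (\<lambda>(i, j). \<Sum>k<m. of_bool (vs ! i \<in> g k) * c j k) = ?C"
    using vs by (intro eq_matI) (auto simp: c nth_eq_iff_index_eq simp del: sum_of_bool_mult_eq)
  have "det ?C = prod_list (diag_mat ?C)"
    by (rule det_upper_triangular[of _ ?n]) (auto simp: upper_triangular_def)
  \<comment> \<open>The odd length at the root turns the corner entry into
    \<open>1 + 1\<close>.\<close>
  also have "\<dots> = (\<Prod>i\<in>{0..<?n}. if i = 0 then 2 else 1)"
    unfolding prod_list_diag_prod using p by (intro prod.cong) auto
  also have "\<dots> = 2" using vs(2) by simp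
  finally show ?thesis using that[of "\<lambda>k j. c j k"] C by simp
qed

text \<open>The determinant is even, and edge combinations of determinant 2 show that it divides 2.
  The cycle hypothesis concerns the ambient edge set \<open>E\<close>, because odd cycles of the
  selected subgraph are also cycles there.\<close>

lemma abs_det_spanning_subgraph:
  fixes g :: "nat \<Rightarrow> 'a set"
  defines "B vs \<equiv> mat (length vs) (length vs) (\<lambda>(i, j). of_bool (vs ! i \<in> g j)) :: int mat"
  assumes vs: "distinct vs" "vs \<noteq> []"
    and g: "\<forall>k<length vs. card (g k) = 2 \<and> g k \<subseteq> set vs \<and> g k \<in> E"
    and cyc: "\<And>c c'. is_odd_cycle (set vs) E c \<Longrightarrow> is_odd_cycle (set vs) E c' \<Longrightarrow> set c \<inter> set c' \<noteq> {}"
    and nz: "det (B vs) \<noteq> 0"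
  shows "\<bar>det (B vs)\<bar> = 2"
proof -
  let ?n = "length vs" and ?V = "set vs"
  let ?F = "g ` {..<?n}"
  let ?W = "walk_betw ?V ?F"
  have B: "B vs \<in> carrier_mat ?n ?n" by (simp add: B_def)
  have sum: "(\<Sum>i<?n. S (vs ! i) * B vs $$ (i, j)) = S x + S y"
    if "j < ?n" "g j = {x, y}" for S :: "'a \<Rightarrow> int" and j x y
  proof -
    have "x \<noteq> y" "x \<in> ?V" "y \<in> ?V" using g that by fastforce+
    with that show ?thesis using sum_edge_signs[OF vs(1), of x y S] by (simp add: B_def)
  qed
  have edge: "\<exists>x y. g j = {x, y}" if "j < ?n" for j
    using g that by (metis card_2_iff)
  \<comment> \<open>All row weights are 1, since each column sums to 2.\<close>
  have "2 dvd 1 * det (B vs)"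
  proof (rule dvd_det_row_combination[OF B, of 0])
    fix j assume j: "j < ?n"
    then obtain x y where "g j = {x, y}" using edge by blast
    from sum[OF j this, of "\<lambda>_. 1"] show "2 dvd (\<Sum>i<?n. 1 * B vs $$ (i, j))" by simp
  qed (use vs(2) in simp)
  then have even: "2 dvd det (B vs)" by simp
  \<comment> \<open>Otherwise the component of \<open>v\<close> is bipartite, and its signs form a
    left kernel vector that is nonzero at \<open>v\<close>.\<close>
  have odd_walk: "\<exists>p. ?W v p v \<and> odd (walk_length p)" if v: "v \<in> ?V" for v
  proof (rule ccontr)
    assume "\<not> ?thesis"
    then have no: "even (walk_length p)" if "?W v p v" for p using that by blast
    have "\<Union>?F \<subseteq> ?V" using g by auto
    obtain S :: "'a \<Rightarrow> int" where S: "\<And>w p. ?W v p w \<Longrightarrow> S w \<in> {1, -1}"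
      and S0: "\<And>x y. {x, y} \<in> ?F \<Longrightarrow> S x + S y = 0"
      using bipartite_component_signs[OF \<open>\<Union>?F \<subseteq> ?V\<close> v no] by blast
    obtain k where k: "k < ?n" "v = vs ! k" using v by (auto simp: in_set_conv_nth)
    have "0 dvd S (vs ! k) * det (B vs)"
    proof (rule dvd_det_row_combination[OF B k(1)])
      fix j assume j: "j < ?n"
      then obtain x y where xy: "g j = {x, y}" using edge by blast
      then have "S x + S y = 0" using S0 j by blast
      then show "0 dvd (\<Sum>i<?n. S (vs ! i) * B vs $$ (i, j))" using sum[OF j xy] by simp
    qed
    then show False using S[OF walk_betw_singleton[OF v]] nz k by auto
  qed
  have FE: "?F \<subseteq> E" and Fcard: "\<forall>e\<in>?F. card e = 2" using g by auto
  \<comment> \<open>The cycle need not pass through \<open>v\<close>; what counts is that it lies on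
    a closed walk at \<open>v\<close>, hence in the component of \<open>v\<close>.\<close>
  have odd_cycle: "\<exists>c p. is_odd_cycle ?V E c \<and> set c \<subseteq> set p \<and> ?W v p v" if v: "v \<in> ?V" for v
  proof -
    obtain p where p: "?W v p v" "odd (walk_length p)" using odd_walk[OF v] by blast
    then obtain c where c: "is_odd_cycle ?V ?F c" "set c \<subseteq> set p"
      by (rule odd_closed_walk_imp_odd_cycle[OF Fcard])
    then have "successively (\<lambda>u v. {u, v} \<in> ?F) c"
      by (simp add: is_odd_cycle_def is_cycle_def is_walk_def)
    then have "successively (\<lambda>u v. {u, v} \<in> E) c"
      by (rule successively_mono) (use FE in blast)
    with c(1) have "is_odd_cycle ?V E c"
      by (simp add: is_odd_cycle_def is_cycle_def is_walk_def)
    with c p show ?thesis by blast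
  qed
  have conn: "\<exists>p. ?W v p (vs ! 0)" if v: "v \<in> ?V" for v
  proof -
    obtain c p where 1: "is_odd_cycle ?V E c" "set c \<subseteq> set p" "?W v p v"
      using odd_cycle[OF v] by blast
    have "vs ! 0 \<in> ?V" using vs(2) by simp
    then obtain c' p' where 2: "is_odd_cycle ?V E c'" "set c' \<subseteq> set p'" "?W (vs ! 0) p' (vs ! 0)"
      using odd_cycle by blast
    \<comment> \<open>A common vertex of the two cycles lies on both closed walks, so prefixes of
      these join \<open>v\<close> to the root.\<close>
    obtain w where w: "w \<in> set p" "w \<in> set p'" using cyc[OF 1(1) 2(1)] 1(2) 2(2) by blast
    obtain q where q: "?W v q w" using walk_betw_prefix[OF 1(3) w(1)] .
    obtain q' where q': "?W (vs ! 0) q' w" using walk_betw_prefix[OF 2(3) w(2)] .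
    show ?thesis using walk_betw_append(1)[OF q walk_betw_rev[OF q']] by blast
  qed
  obtain q where q: "?W (vs ! 0) q (vs ! 0)" "odd (walk_length q)"
    using odd_walk[of "vs ! 0"] vs(2) by auto
  have "\<forall>k<?n. card (g k) = 2" using g by blast
  from exists_edge_combination_det_2[OF vs this conn q] obtain x :: "nat \<Rightarrow> nat \<Rightarrow> int"
    where x: "det (mat ?n ?n (\<lambda>(i, j). \<Sum>k<?n. of_bool (vs ! i \<in> g k) * x k j)) = 2" .
  \<comment> \<open>The coefficients form an integer matrix, so \<open>det (B vs)\<close> divides 2
    in the integers.\<close>
  let ?X = "mat ?n ?n (\<lambda>(k, j). x k j)"
  have "mat ?n ?n (\<lambda>(i, j). \<Sum>k<?n. of_bool (vs ! i \<in> g k) * x k j) = B vs * ?X"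
    by (intro eq_matI) (auto simp: B_def scalar_prod_def lessThan_atLeast0 intro!: sum.cong)
  then have "det (B vs) * det ?X = 2" using x det_mult[OF B, of ?X] by simp
  then have "det (B vs) dvd 2" by (metis dvd_triv_left)
  with even show ?thesis by (metis abs_numeral zdvd_antisym_abs)
qed

text \<open>Alternation around an odd closed walk gives \<open>S u = - S u\<close>, and the zero
  then spreads along the walk.\<close>

lemma signs_vanish_on_odd_cycle:
  fixes S :: "'a \<Rightarrow> int"
  assumes c: "walk_betw V F u c u" "odd (walk_length c)" and v: "v \<in> set c"
    and S: "\<And>x y. {x, y} \<in> F \<Longrightarrow> S x + S y = 0"
  shows "S v = 0"
proof -
  have "S u = 0" using alternating_along_walk[OF c(1) S] c(2) by simp
  moreover obtain q where "walk_betw V F u q v"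
    using walk_betw_prefix[OF c(1) v] .
  ultimately show ?thesis using alternating_along_walk[of V F u q v S] S by simp
qed

text \<open>The indicator of an edge splits into those of its two distinct ends, and reindexing by
  \<open>\<sigma>\<close> makes the two sums equal.\<close>

lemma even_sum_successor_edges:
  assumes C: "finite C" and \<sigma>: "bij_betw \<sigma> C C" "\<And>v. v \<in> C \<Longrightarrow> v \<noteq> \<sigma> v"
  shows "even (\<Sum>v\<in>C. of_bool (w \<in> {v, \<sigma> v}) :: int)"
proof -
  have "(\<Sum>v\<in>C. of_bool (w \<in> {v, \<sigma> v}) :: int) = (\<Sum>v\<in>C. of_bool (w = v)) + (\<Sum>v\<in>C. of_bool (w = \<sigma> v))"
    unfolding sum.distrib[symmetric]
  proof (intro sum.cong refl)
    fix v assume "v \<in> C"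
    then show "of_bool (w \<in> {v, \<sigma> v}) = (of_bool (w = v) + of_bool (w = \<sigma> v) :: int)"
      using \<sigma>(2)[of v] by auto
  qed
  also have "(\<Sum>v\<in>C. of_bool (w = \<sigma> v) :: int) = (\<Sum>v\<in>C. of_bool (w = v))"
    by (rule sum.reindex_bij_betw[OF \<sigma>(1)])
  finally show ?thesis by simp
qed

text \<open>A factor 2 is pulled out of a column in \<open>S\<close> and then out of a column in
  \<open>T\<close>; the first step leaves the columns of \<open>T\<close> untouched.\<close>

lemma four_dvd_det_two_even_column_sets:
  fixes N :: "int mat"
  assumes N: "N \<in> carrier_mat n n" and S: "S \<subseteq> {..<n}" "S \<noteq> {}" and T: "T \<subseteq> {..<n}" "T \<noteq> {}"
    and disj: "S \<inter> T = {}"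
    and even: "\<And>i. i < n \<Longrightarrow> even (\<Sum>j\<in>S. N $$ (i, j))" "\<And>i. i < n \<Longrightarrow> even (\<Sum>j\<in>T. N $$ (i, j))"
  shows "4 dvd det N"
proof -
  obtain k l where kl: "k \<in> S" "l \<in> T" using S T by blast
  obtain N' where N': "N' \<in> carrier_mat n n" "det N = 2 * det N'"
    "\<And>i j. i < n \<Longrightarrow> j < n \<Longrightarrow> j \<noteq> k \<Longrightarrow> N' $$ (i, j) = N $$ (i, j)"
    by (rule dvd_det_column_sum[OF N S(1) kl(1) even(1)]) blast+
  have "even (\<Sum>j\<in>T. N' $$ (i, j))" if "i < n" for i
  proof -
    have "(\<Sum>j\<in>T. N' $$ (i, j)) = (\<Sum>j\<in>T. N $$ (i, j))"
      using that T disj kl by (intro sum.cong N'(3)) auto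
    then show ?thesis using even(2)[OF that] by simp
  qed
  from dvd_det_column_sum[OF N'(1) T(1) kl(2) this] obtain N'' where "det N' = 2 * det N''" by metis
  then show ?thesis using N'(2) by simp
qed

section \<open>Column selections of the incidence matrix\<close>

lemma incidence_matrix_carrier: "incidence_matrix vs es \<in> carrier_mat (length vs) (length es)"
  by (simp add: incidence_matrix_def)

lemma incidence_matrix_index:
  "i < length vs \<Longrightarrow> k < length es \<Longrightarrow> incidence_matrix vs es $$ (i, k) = of_bool (vs ! i \<in> es ! k)"
  by (simp add: incidence_matrix_def)

lemma incidence_matrix_select_columns:
  assumes "\<And>j. j < length vs \<Longrightarrow> f j < length es"
  shows "mat (length vs) (length vs) (\<lambda>(i, j). incidence_matrix vs es $$ (i, f j)) =
    mat (length vs) (length vs) (\<lambda>(i, j). of_bool (vs ! i \<in> es ! f j))"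
  using assms by (intro eq_matI) (auto simp: incidence_matrix_index)

text \<open>This passes from column choices \<open>f\<close>, as the expansion produces them, to
  \<open>minors\<close>, which are built from index sets. It also fixes the rank, and with it the
  size of the minors that unimodularity compares.\<close>

lemma incidence_selection_minor:
  fixes vs :: "'a list"
  assumes f: "\<And>j. j < length vs \<Longrightarrow> f j < length es"
    and nz: "det (mat (length vs) (length vs) (\<lambda>(i, j). of_bool (vs ! i \<in> es ! f j)) :: int mat) \<noteq> 0"
  shows "int_mat_rank (incidence_matrix vs es) = length vs"
    and "\<exists>y \<in> minors (length vs) (incidence_matrix vs es).
      \<bar>y\<bar> = \<bar>det (mat (length vs) (length vs) (\<lambda>(i, j). of_bool (vs ! i \<in> es ! f j)))\<bar>"
proof -
  let ?A = "incidence_matrix vs es" and ?n = "length vs"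
  note A = incidence_matrix_carrier[of vs es]
  have sel: "det (mat ?n ?n (\<lambda>(i, j). ?A $$ (i, f j))) = det (mat ?n ?n (\<lambda>(i, j). of_bool (vs ! i \<in> es ! f j)))"
    by (rule arg_cong[OF incidence_matrix_select_columns]) (rule f)
  have nzA: "det (mat ?n ?n (\<lambda>(i, j). ?A $$ (i, f j))) \<noteq> 0" using nz sel by metis
  show "int_mat_rank ?A = ?n" by (rule int_mat_rank_full[OF A f nzA])
  have inj: "inj_on f {..<?n}"
    by (rule det_select_distinct_columns[of ?n "\<lambda>i k. of_bool (vs ! i \<in> es ! k) :: int", OF nz])
  have im: "f ` {..<?n} \<subseteq> {..<length es}" using f by auto
  have "det (submatrix ?A {..<?n} (f ` {..<?n})) \<in> minors ?n ?A"
    unfolding minors_def mem_Collect_eq using A im inj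
    by (intro exI[of _ "{..<?n}"] exI[of _ "f ` {..<?n}"]) (auto simp: card_image)
  then show "\<exists>y \<in> minors ?n ?A. \<bar>y\<bar> = \<bar>det (mat ?n ?n (\<lambda>(i, j). of_bool (vs ! i \<in> es ! f j)))\<bar>"
    unfolding sel[symmetric] by (rule bexI[rotated]) (simp add: abs_det_select_columns[OF A inj im])
qed

section \<open>The bipartite case\<close>

lemma two_colouring:
  assumes V: "\<Union>E \<subseteq> V" and card: "\<forall>e\<in>E. card e = 2" and conn: "connected_graph V E"
    and no: "\<nexists>c. is_odd_cycle V E c"
  obtains s :: "'a \<Rightarrow> int" where "\<And>v. v \<in> V \<Longrightarrow> s v \<in> {1, -1}"
    "\<And>x y. {x, y} \<in> E \<Longrightarrow> s x + s y = 0"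
proof (cases "V = {}")
  case True
  then have "E = {}" using V card by fastforce
  then show ?thesis using that[of "\<lambda>_. 1"] by simp
next
  case False
  then obtain r where r: "r \<in> V" by blast
  have even: "even (walk_length p)" if "walk_betw V E r p r" for p
    using odd_closed_walk_imp_odd_cycle[OF card that] no by blast
  obtain s :: "'a \<Rightarrow> int" where s: "\<And>v p. walk_betw V E r p v \<Longrightarrow> s v \<in> {1, -1}"
    "\<And>x y. {x, y} \<in> E \<Longrightarrow> s x + s y = 0"
    using bipartite_component_signs[OF V r even] by blast
  \<comment> \<open>Connectedness puts every vertex into the component of \<open>r\<close>, so no
    sign is 0.\<close>
  have "s v \<in> {1, -1}" if v: "v \<in> V" for v
    using conn r v s(1) unfolding connected_graph_def walk_betw_def by blast
  then show ?thesis using that s(2) by blast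
qed

text \<open>Rows inherit the colours of their vertices, and two ones in a column sit at the two ends
  of an edge. The bound covers every size \<open>k\<close>, so the rank need not be computed in the
  bipartite case.\<close>

lemma abs_minor_bipartite:
  assumes E: "\<forall>e\<in>set es. card e = 2"
    and s: "\<And>v. v \<in> set vs \<Longrightarrow> s v \<in> {1, -1 :: int}" "\<And>x y. {x, y} \<in> set es \<Longrightarrow> s x + s y = 0"
    and vs: "distinct vs" and y: "y \<in> minors k (incidence_matrix vs es)"
  shows "\<bar>y\<bar> \<le> 1"
proof -
  let ?A = "incidence_matrix vs es"
  obtain I J where y: "y = det (submatrix ?A I J)" and IJ: "I \<subseteq> {..<length vs}" "J \<subseteq> {..<length es}"
    and card: "card I = k" "card J = k"
    using y incidence_matrix_carrier[of vs es] by (auto simp: minors_def)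
  have "{i. i < dim_row ?A \<and> i \<in> I} = I" "{j. j < dim_col ?A \<and> j \<in> J} = J"
    using IJ incidence_matrix_carrier[of vs es] by auto
  then have S: "submatrix ?A I J = mat k k (\<lambda>(i, j). ?A $$ (pick I i, pick J j))"
    by (simp only: submatrix_def card)
  have pI: "pick I i < length vs" and pJ: "pick J i < length es" if "i < k" for i
    using pick_in_set[of i I] pick_in_set[of i J] that card IJ by auto
  have inj: "pick I i \<noteq> pick I i'" if "i < k" "i' < k" "i \<noteq> i'" for i i'
    using card_pick[of i I] card_pick[of i' I] that card by auto
  \<comment> \<open>\<open>det_two_coloured_rows\<close> asks for a sign at every natural number,
    whence the default 1.\<close>
  define t where "t i = (if i < k then s (vs ! pick I i) else 1)" for i
  show ?thesis unfolding y
  proof (rule det_two_coloured_rows[of _ k t])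
    show "submatrix ?A I J \<in> carrier_mat k k" by (simp add: S)
    show "submatrix ?A I J $$ (i, j) \<in> {0, 1}" if "i < k" "j < k" for i j
      using that pI pJ by (simp add: S incidence_matrix_index)
    show "t i \<in> {1, -1}" for i using s(1) pI by (simp add: t_def)
    fix i i' j assume i: "i < k" "i' < k" "j < k" "i \<noteq> i'"
      and 1: "submatrix ?A I J $$ (i, j) = 1" "submatrix ?A I J $$ (i', j) = 1"
    let ?u = "vs ! pick I i" and ?w = "vs ! pick I i'" and ?e = "es ! pick J j"
    have "?u \<in> ?e" "?w \<in> ?e" using 1 i pI pJ by (auto simp: S incidence_matrix_index)
    moreover have "?u \<noteq> ?w" using inj i pI vs by (simp add: nth_eq_iff_index_eq)
    moreover have e: "?e \<in> set es" using pJ i by simp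
    ultimately have "?e = {?u, ?w}" using E by (metis card_2_iff insertE singletonD doubleton_eq_iff)
    then show "t i + t i' = 0" using s(2) e i by (simp add: t_def)
  qed
qed

section \<open>Maximal minors and the factor 4\<close>

lemma minor_not_dvd_4:
  fixes vs :: "'a list"
  assumes vs: "distinct vs" "vs \<noteq> []" and es: "\<forall>e\<in>set es. card e = 2"
    and conn: "connected_graph (set vs) (set es)" and c: "is_odd_cycle (set vs) (set es) c"
  shows "int_mat_rank (incidence_matrix vs es) = length vs"
    and "\<exists>y \<in> minors (length vs) (incidence_matrix vs es). \<not> 4 dvd y"
proof -
  let ?n = "length vs" and ?m = "length es" and ?W = "walk_betw (set vs) (set es)"
  have walk: "\<exists>p. ?W u p v" if "u \<in> set vs" "v \<in> set vs" for u v
    using conn that by (simp add: connected_graph_def walk_betw_def)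
  have cyc: "?W (hd c) c (hd c)" "odd (walk_length c)"
    using c by (auto simp: is_odd_cycle_def is_cycle_def walk_betw_def)
  have E: "(\<lambda>k. es ! k) ` {..<?m} = set es" by (auto simp: set_conv_nth)
  have r: "vs ! 0 \<in> set vs" using vs(2) by simp
  then obtain p where "?W (vs ! 0) p (hd c)" using walk walk_betw_in[OF cyc(1)] by blast
  then obtain q where q: "?W (vs ! 0) q (vs ! 0)" "odd (walk_length q)"
    using odd_closed_walk_conjugate[OF _ cyc] by blast
  obtain x :: "nat \<Rightarrow> nat \<Rightarrow> int" where
    "det (mat ?n ?n (\<lambda>(i, j). \<Sum>k<?m. of_bool (vs ! i \<in> es ! k) * x k j)) = 2"
    by (rule exists_edge_combination_det_2[OF vs, where m = ?m and g = "nth es"])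
      (use es walk r q E in auto)
  \<comment> \<open>Since 4 does not divide 2, the expansion contains a column choice whose
    determinant is not divisible by 4; being nonzero, it also yields the rank.\<close>
  then have "\<not> 4 dvd det (mat ?n ?n (\<lambda>(i, j). \<Sum>k<?m. of_bool (vs ! i \<in> es ! k) * x k j))" by simp
  then obtain f where f: "\<And>j. j < ?n \<Longrightarrow> f j < ?m"
    and 4: "\<not> 4 dvd det (mat ?n ?n (\<lambda>(i, j). of_bool (vs ! i \<in> es ! f j)) :: int mat)"
    by (rule not_dvd_det_mult_obtain_columns) blast
  then have nz: "det (mat ?n ?n (\<lambda>(i, j). of_bool (vs ! i \<in> es ! f j)) :: int mat) \<noteq> 0" by auto
  show "int_mat_rank (incidence_matrix vs es) = ?n" by (rule incidence_selection_minor(1)[OF f nz])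
  obtain y where y: "y \<in> minors ?n (incidence_matrix vs es)"
    "\<bar>y\<bar> = \<bar>det (mat ?n ?n (\<lambda>(i, j). of_bool (vs ! i \<in> es ! f j)))\<bar>"
    using incidence_selection_minor(2)[OF f nz] by blast
  then have "\<not> 4 dvd y" using 4 by (metis dvd_abs_iff)
  with y(1) show "\<exists>y \<in> minors ?n (incidence_matrix vs es). \<not> 4 dvd y" by blast
qed

text \<open>A nonzero maximal minor whose columns include the edges of both cycles is found by
  expanding the determinant of a matrix that has these edges as columns and, in the column of
  any other vertex \<open>v\<close>, the vector \<open>v \<plusminus> h\<close> for a fixed vertex \<open>h\<close> of the first
  cycle.\<close>

lemma minor_dvd_4:
  fixes vs :: "'a list"
  assumes vs: "distinct vs" and es: "\<forall>e\<in>set es. card e = 2 \<and> e \<subseteq> set vs"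
    and conn: "connected_graph (set vs) (set es)"
    and odd: "is_odd_cycle (set vs) (set es) c" "is_odd_cycle (set vs) (set es) c'"
    and disj: "set c \<inter> set c' = {}"
  shows "\<exists>y \<in> minors (length vs) (incidence_matrix vs es). y \<noteq> 0 \<and> 4 dvd y"
proof -
  let ?n = "length vs" and ?m = "length es" and ?W = "walk_betw (set vs) (set es)"
  have E: "(\<lambda>k. es ! k) ` {..<?m} = set es" by (auto simp: set_conv_nth)
  have cyc: "is_cycle (set vs) (set es) c" "is_cycle (set vs) (set es) c'"
    and len: "odd (walk_length c)" "odd (walk_length c')"
    using odd by (simp_all add: is_odd_cycle_def)
  have sub: "set c \<subseteq> set vs" "set c' \<subseteq> set vs" and ne: "c \<noteq> []" "c' \<noteq> []"
    using cyc by (simp_all add: is_cycle_def is_walk_def)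
  obtain \<sigma> where \<sigma>: "bij_betw \<sigma> (set c) (set c)" "\<And>v. v \<in> set c \<Longrightarrow> {v, \<sigma> v} \<in> set es"
    "walk_betw (set c) ((\<lambda>v. {v, \<sigma> v}) ` set c) (hd c) c (hd c)"
    using cycle_successor[OF cyc(1)] by blast
  obtain \<tau> where \<tau>: "bij_betw \<tau> (set c') (set c')" "\<And>v. v \<in> set c' \<Longrightarrow> {v, \<tau> v} \<in> set es"
    "walk_betw (set c') ((\<lambda>v. {v, \<tau> v}) ` set c') (hd c') c' (hd c')"
    using cycle_successor[OF cyc(2)] by blast
  \<comment> \<open>The cycle edge leaving \<open>v\<close>; as the cycles are disjoint, testing for
    the first one suffices.\<close>
  define h where "h v = (if v \<in> set c then {v, \<sigma> v} else {v, \<tau> v})" for v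
  have h: "h v \<in> set es" if "v \<in> set c \<union> set c'" for v
    using that \<sigma>(2) \<tau>(2) by (auto simp: h_def)
  \<comment> \<open>At a cycle vertex the coefficients represent the edge \<open>h v\<close> and are
    supported on it alone, so that a later column choice has to pick it. At any other vertex only
    the resulting vector matters, and \<open>l\<close> stands for the length of a walk to
    \<open>hd c\<close>.\<close>
  define good :: "'a \<Rightarrow> (nat \<Rightarrow> int) \<Rightarrow> bool" where "good v x \<longleftrightarrow>
    (if v \<in> set c \<union> set c' then
      (\<forall>w. (\<Sum>k<?m. of_bool (w \<in> es ! k) * x k) = of_bool (w \<in> h v)) \<and>
      (\<forall>k<?m. x k \<noteq> 0 \<longrightarrow> es ! k = h v)
    else \<exists>l. \<forall>w. (\<Sum>k<?m. of_bool (w \<in> es ! k) * x k) =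
      of_bool (w = v) - (-1) ^ l * of_bool (w = hd c))" for v x
  have "\<exists>x. good v x" if v: "v \<in> set vs" for v
  proof (cases "v \<in> set c \<union> set c'")
    case True
    then obtain e where e: "e < ?m" "es ! e = h v" using h by (metis in_set_conv_nth)
    have "(\<Sum>k<?m. of_bool (w \<in> es ! k) * of_bool (k = e)) = (of_bool (w \<in> h v) :: int)" for w
    proof -
      have "(\<Sum>k<?m. of_bool (w \<in> es ! k) * of_bool (k = e)) =
          (\<Sum>k<?m. if k = e then of_bool (w \<in> h v) else 0 :: int)"
        using e by (intro sum.cong) auto
      then show ?thesis using e by simp
    qed
    then have "good v (\<lambda>k. of_bool (k = e))"
      unfolding good_def if_P[OF True] using e(2) by (intro conjI allI impI) (auto split: if_splits)
    then show ?thesis by (rule exI[of "good v"])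
  next
    case False
    have "hd c \<in> set vs" using sub ne by auto
    then obtain p where p: "?W v p (hd c)"
      using conn v unfolding connected_graph_def walk_betw_def by blast
    obtain x :: "nat \<Rightarrow> int" where "\<And>w. (\<Sum>k<?m. of_bool (w \<in> es ! k) * x k) =
        of_bool (w = v) - (-1) ^ walk_length p * of_bool (w = hd c)"
      by (rule walk_edge_combination[where g = "nth es" and m = ?m]) (use p es E in auto)
    then have "good v x" unfolding good_def if_not_P[OF False] by blast
    then show ?thesis by (rule exI[of "good v"])
  qed
  then obtain x where x: "good v (x v)" if "v \<in> set vs" for v by metis
  have x_cycle: "(\<Sum>k<?m. of_bool (w \<in> es ! k) * x v k) = of_bool (w \<in> h v)"
    "k < ?m \<Longrightarrow> x v k \<noteq> 0 \<Longrightarrow> es ! k = h v" if "v \<in> set c \<union> set c'" for v w k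
  proof -
    have "good v (x v)" using x that sub by blast
    then show "(\<Sum>k<?m. of_bool (w \<in> es ! k) * x v k) = of_bool (w \<in> h v)"
      "k < ?m \<Longrightarrow> x v k \<noteq> 0 \<Longrightarrow> es ! k = h v"
      unfolding good_def if_P[OF that] by blast+
  qed
  let ?M = "mat ?n ?n (\<lambda>(i, j). \<Sum>k<?m. of_bool (vs ! i \<in> es ! k) * x (vs ! j) k)"
  \<comment> \<open>A left kernel vector \<open>S\<close> alternates around both odd cycles and so
    vanishes there; the columns \<open>v \<plusminus> hd c\<close> then force it to vanish at every
    other \<open>v\<close>.\<close>
  have "det ?M \<noteq> 0"
  proof (rule det_nonzero_vertex_signs[OF vs])
    fix S :: "'a \<Rightarrow> int" and v
    assume ker: "\<And>j. j < ?n \<Longrightarrow> (\<Sum>i<?n. S (vs ! i) * ?M $$ (i, j)) = 0"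
    have zero: "(\<Sum>i<?n. S (vs ! i) * (\<Sum>k<?m. of_bool (vs ! i \<in> es ! k) * x u k)) = 0"
      if "u \<in> set vs" for u
    proof -
      obtain j where j: "j < ?n" "u = vs ! j" using \<open>u \<in> set vs\<close> by (metis in_set_conv_nth)
      have "(\<Sum>i<?n. S (vs ! i) * (\<Sum>k<?m. of_bool (vs ! i \<in> es ! k) * x u k)) =
          (\<Sum>i<?n. S (vs ! i) * ?M $$ (i, j))"
        unfolding j(2) by (intro sum.cong refl) (use j(1) in \<open>simp del: sum_of_bool_mult_eq\<close>)
      then show ?thesis using ker[OF j(1)] by presburger
    qed
    have cycle_edge: "S u + S w = 0" if u: "u \<in> set c \<union> set c'" and w: "h u = {u, w}" for u w
    proof -
      have uV: "u \<in> set vs" using u sub by blast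
      have "card {u, w} = 2" "{u, w} \<subseteq> set vs" using h[OF u] es w by metis+
      then have uw: "u \<noteq> w" "w \<in> set vs" by auto
      have "(\<Sum>k<?m. of_bool (z \<in> es ! k) * x u k) = of_bool (z \<in> {u, w})" for z
        unfolding w[symmetric] by (rule x_cycle(1)[OF u])
      then have "(\<Sum>i<?n. S (vs ! i) * of_bool (vs ! i \<in> {u, w})) = 0"
        using zero[OF uV] by presburger
      then show ?thesis using sum_edge_signs[OF vs uV uw(2,1), of S] by presburger
    qed
    have 1: "S y + S z = 0" if yz: "{y, z} \<in> (\<lambda>v. {v, \<sigma> v}) ` set c" for y z
    proof -
      obtain u where u: "u \<in> set c" "{y, z} = {u, \<sigma> u}" using yz by blast
      then have "S u + S (\<sigma> u) = 0" using cycle_edge by (simp add: h_def)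
      then show ?thesis using u(2) by (auto simp: doubleton_eq_iff)
    qed
    have 2: "S y + S z = 0" if yz: "{y, z} \<in> (\<lambda>v. {v, \<tau> v}) ` set c'" for y z
    proof -
      obtain u where u: "u \<in> set c'" "{y, z} = {u, \<tau> u}" using yz by blast
      then have "h u = {u, \<tau> u}" using disj by (auto simp: h_def)
      with u(1) have "S u + S (\<tau> u) = 0" using cycle_edge by blast
      then show ?thesis using u(2) by (auto simp: doubleton_eq_iff)
    qed
    have S0: "S u = 0" if "u \<in> set c \<union> set c'" for u
      using that
    proof
      assume "u \<in> set c"
      then show ?thesis using 1 by (rule signs_vanish_on_odd_cycle[where S = S, OF \<sigma>(3) len(1)])
    next
      assume "u \<in> set c'"
      then show ?thesis using 2 by (rule signs_vanish_on_odd_cycle[where S = S, OF \<tau>(3) len(2)])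
    qed
    assume v: "v \<in> set vs"
    show "S v = 0"
    proof (cases "v \<in> set c \<union> set c'")
      case False
      obtain l where l: "\<And>w. (\<Sum>k<?m. of_bool (w \<in> es ! k) * x v k) =
          of_bool (w = v) - (-1) ^ l * of_bool (w = hd c)" 
        using x[OF v] unfolding good_def if_not_P[OF False] by blast
      have "(\<Sum>i<?n. S (vs ! i) * (of_bool (vs ! i = v) - (-1) ^ l * of_bool (vs ! i = hd c))) =
          (\<Sum>w\<in>set vs. S w * (of_bool (w = v) - (-1) ^ l * of_bool (w = hd c)))"
        by (rule sum_nth_distinct[OF vs])
      also have "\<dots> = (\<Sum>w\<in>set vs. if w = v then S w else 0)"
        using S0 ne(1) by (intro sum.cong) auto
      finally show ?thesis using zero[OF v] v unfolding l by simp
    qed (rule S0)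
  qed simp
  then have "\<not> 0 dvd det ?M" by simp
  then obtain f where f: "\<And>j. j < ?n \<Longrightarrow> f j < ?m" and fx: "\<And>j. j < ?n \<Longrightarrow> x (vs ! j) (f j) \<noteq> 0"
    and nz: "\<not> 0 dvd det (mat ?n ?n (\<lambda>(i, j). of_bool (vs ! i \<in> es ! f j)) :: int mat)"
    by (rule not_dvd_det_mult_obtain_columns) blast
  let ?N = "mat ?n ?n (\<lambda>(i, j). of_bool (vs ! i \<in> es ! f j)) :: int mat"
  \<comment> \<open>A nonzero coefficient leaves one possible edge at a cycle vertex, so the chosen
    columns include all edges of both cycles.\<close>
  have fh: "es ! f j = h (vs ! j)" if "j < ?n" "vs ! j \<in> set c \<union> set c'" for j
    by (rule x_cycle(2)[OF that(2) f[OF that(1)] fx[OF that(1)]])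
  \<comment> \<open>Formulated for any \<open>C\<close> with a successor map \<open>\<rho>\<close>,
    so that it serves both cycles.\<close>
  have even: "even (\<Sum>j | j < ?n \<and> vs ! j \<in> C. ?N $$ (i, j))"
    if i: "i < ?n" and C: "C \<subseteq> set c \<union> set c'" and \<rho>: "bij_betw \<rho> C C" "\<And>v. v \<in> C \<Longrightarrow> h v = {v, \<rho> v}"
    for i C \<rho>
  proof -
    have CV: "C \<subseteq> set vs" and fin: "finite C" using C sub by (auto intro: finite_subset)
    have "v \<noteq> \<rho> v" if v: "v \<in> C" for v
    proof -
      have "h v \<in> set es" using h C v by blast
      then have "card {v, \<rho> v} = 2" using es \<rho>(2)[OF v] by metis
      then show ?thesis by auto
    qed
    note ev = even_sum_successor_edges[OF fin \<rho>(1) this, of "vs ! i"]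
    have "(\<Sum>j | j < ?n \<and> vs ! j \<in> C. ?N $$ (i, j)) =
        (\<Sum>j | j < ?n \<and> vs ! j \<in> C. of_bool (vs ! i \<in> {vs ! j, \<rho> (vs ! j)}))"
      using i C fh \<rho>(2) by (intro sum.cong) auto
    also have "\<dots> = (\<Sum>v\<in>C. of_bool (vs ! i \<in> {v, \<rho> v}))"
    proof (rule sum.reindex_bij_betw)
      have "inj_on (nth vs) {j. j < ?n \<and> vs ! j \<in> C}" using vs by (intro inj_on_nth) auto
      moreover have "nth vs ` {j. j < ?n \<and> vs ! j \<in> C} = C"
        using CV by (force simp: in_set_conv_nth subset_iff)
      ultimately show "bij_betw (nth vs) {j. j < ?n \<and> vs ! j \<in> C} C" by (simp add: bij_betw_def)
    qed
    finally show ?thesis using ev by metis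
  qed
  have nonempty: "{j. j < ?n \<and> vs ! j \<in> C} \<noteq> {}" if "v \<in> C" "v \<in> set vs" for v C
    using that by (auto simp: in_set_conv_nth)
  have "4 dvd det ?N"
  proof (rule four_dvd_det_two_even_column_sets)
    show "{j. j < ?n \<and> vs ! j \<in> set c} \<noteq> {}" "{j. j < ?n \<and> vs ! j \<in> set c'} \<noteq> {}"
      using nonempty[of "hd c"] nonempty[of "hd c'"] ne sub by (auto simp: subset_iff)
    show "{j. j < ?n \<and> vs ! j \<in> set c} \<inter> {j. j < ?n \<and> vs ! j \<in> set c'} = {}" using disj by auto
    show "even (\<Sum>j | j < ?n \<and> vs ! j \<in> set c. ?N $$ (i, j))" if "i < ?n" for i
      by (rule even[OF that _ \<sigma>(1)]) (simp_all add: h_def)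
    show "even (\<Sum>j | j < ?n \<and> vs ! j \<in> set c'. ?N $$ (i, j))" if "i < ?n" for i
      by (rule even[OF that _ \<tau>(1)]) (use disj in \<open>auto simp: h_def\<close>)
  qed auto
  moreover have nz': "det ?N \<noteq> 0" using nz by simp
  moreover obtain y where "y \<in> minors ?n (incidence_matrix vs es)" "\<bar>y\<bar> = \<bar>det ?N\<bar>"
    using incidence_selection_minor(2)[OF f nz'] by blast
  ultimately show ?thesis by (metis abs_eq_0 dvd_abs_iff)
qed

theorem theorem1p1:
  fixes V :: "'a set" and E :: "'a set set" and vs :: "'a list" and es :: "'a set list"
  assumes "finite_simple_graph V E"
    and "connected_graph V E"
    and "distinct vs" and "set vs = V"
    and "distinct es" and "set es = E"
  shows "unimodular (incidence_matrix vs es) \<longleftrightarrow>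
    (\<forall>c c'. is_odd_cycle V E c \<longrightarrow> is_odd_cycle V E c' \<longrightarrow> set c \<inter> set c' \<noteq> {})"
proof -
  let ?A = "incidence_matrix vs es" and ?n = "length vs"
  have E: "\<forall>e\<in>set es. card e = 2 \<and> e \<subseteq> set vs"
    using assms by (auto simp: finite_simple_graph_def)
  then have card: "\<forall>e\<in>set es. card e = 2" and UE: "\<Union>(set es) \<subseteq> set vs" by auto
  have conn: "connected_graph (set vs) (set es)" using assms by simp
  have odd_ne: "vs \<noteq> []" if "is_odd_cycle (set vs) (set es) c" for c
    using that by (auto simp: is_odd_cycle_def is_cycle_def is_walk_def)
  have "unimodular ?A \<longleftrightarrow> (\<forall>c c'. is_odd_cycle (set vs) (set es) c \<longrightarrow>
      is_odd_cycle (set vs) (set es) c' \<longrightarrow> set c \<inter> set c' \<noteq> {})"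
  proof (intro iffI allI impI notI)
    fix c c' assume uni: "unimodular ?A"
      and odd: "is_odd_cycle (set vs) (set es) c" "is_odd_cycle (set vs) (set es) c'"
      and disj: "set c \<inter> set c' = {}"
    note minor = minor_not_dvd_4[OF assms(3) odd_ne[OF odd(1)] card conn odd(1)]
    obtain x where x: "x \<in> minors ?n ?A" "\<not> 4 dvd x" using minor(2) by blast
    obtain y where y: "y \<in> minors ?n ?A" "y \<noteq> 0" "4 dvd y"
      using minor_dvd_4[OF assms(3) E conn odd disj] by blast
    have "x \<noteq> 0" using x(2) by auto
    \<comment> \<open>Both minors have size \<open>?n\<close>, which is the rank, yet 4 divides only
      one of them.\<close>
    then have "\<bar>x\<bar> = \<bar>y\<bar>" using uni x(1) y(1,2) unfolding unimodular_def minor(1) by blast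
    moreover have "4 dvd \<bar>y\<bar>" "\<not> 4 dvd \<bar>x\<bar>" using x(2) y(3) by simp_all
    ultimately show False by simp
  next
    assume meet: "\<forall>c c'. is_odd_cycle (set vs) (set es) c \<longrightarrow>
      is_odd_cycle (set vs) (set es) c' \<longrightarrow> set c \<inter> set c' \<noteq> {}"
    show "unimodular ?A"
    proof (cases "\<exists>c. is_odd_cycle (set vs) (set es) c")
      case False
      obtain s :: "'a \<Rightarrow> int" where s: "\<And>v. v \<in> set vs \<Longrightarrow> s v \<in> {1, -1}"
        "\<And>x y. {x, y} \<in> set es \<Longrightarrow> s x + s y = 0"
        using two_colouring[OF UE card conn False] by blast
      have "\<bar>x\<bar> = 1" if "x \<in> minors k ?A" "x \<noteq> 0" for x k
        using abs_minor_bipartite[where s = s, OF card s assms(3) that(1)] that(2) by linarith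
      then show ?thesis by (simp add: unimodular_def)
    next
      case True
      then obtain c where c: "is_odd_cycle (set vs) (set es) c" by blast
      note ne = odd_ne[OF c]
      note rank = minor_not_dvd_4(1)[OF assms(3) ne card conn c]
      have "\<bar>x\<bar> = 2" if x: "x \<in> minors ?n ?A" "x \<noteq> 0" for x
      proof -
        obtain I J where IJ: "x = det (submatrix ?A I J)" "I \<subseteq> {..<?n}" "J \<subseteq> {..<length es}"
          "card I = ?n" "card J = ?n"
          using x(1) incidence_matrix_carrier[of vs es] by (auto simp: minors_def)
        \<comment> \<open>A minor of size \<open>?n\<close> uses all rows, so it is given by a
          choice of \<open>?n\<close> edges.\<close>
        have I: "I = {..<?n}" using IJ(2,4) by (intro card_subset_eq) auto
        have pick: "pick J k < length es" if "k < ?n" for k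
          using pick_in_set[of k J] that IJ(3,5) by auto
        let ?B = "mat ?n ?n (\<lambda>(i, j). of_bool (vs ! i \<in> es ! pick J j)) :: int mat"
        have "submatrix ?A I J = ?B"
          unfolding I submatrix_all_rows[OF incidence_matrix_carrier IJ(3)] IJ(5)
          by (rule incidence_matrix_select_columns) (rule pick)
        then have xB: "x = det ?B" using IJ(1) by simp
        show ?thesis unfolding xB
        proof (rule abs_det_spanning_subgraph[OF assms(3) ne])
          show "\<forall>k<?n. card (es ! pick J k) = 2 \<and> es ! pick J k \<subseteq> set vs \<and> es ! pick J k \<in> set es"
            using E pick by simp
          show "set c \<inter> set c' \<noteq> {}" if "is_odd_cycle (set vs) (set es) c"
            "is_odd_cycle (set vs) (set es) c'" for c c'
            using meet that by blast
          show "det ?B \<noteq> 0" using x(2) xB by metis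
        qed
      qed
      then show ?thesis unfolding unimodular_def rank by metis
    qed
  qed
  then show ?thesis using assms by simp
qed

end
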